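(* Let $p\in\mathbb{C}[T]$ with $p(\boldsymbol{1})=1$. The following conditions are equivalent. (i) There exist $r\in\mathbb{N}$ and $h_1,\dots,h_r\in\mathbb{C}[T]$ such that $$1-\sum_{\sigma\in G}p^{\sigma*}p^{\sigma}=\sum_{j=1}^r h_j^*h_j .$$ (ii) There exist $N\in\mathbb{N}$ and $q_1,\dots,q_N\in\mathbb{C}[T]$ such that $$\delta_{\sigma,\tau}-p^{\sigma*}p^{\tau}=\sum_{j=1}^N q_j^{\sigma*}q_j^{\tau}\qquad\text{for all }\sigma,\tau\in G.$$
   Context: Let $d\in\mathbb{N}$ and $\mathbb{C}[T]=\mathbb{C}[z_1^{\pm1},\dots,z_d^{\pm1}]$ be the ring of complex Laurent polynomials, with the involution $*$ given by $z_j^*=z_j^{-1}$ and complex conjugation on coefficients. Laurent polynomials are identified with trigonometric polynomials via $z=\boldsymbol{e}^{-i\omega}=(e^{-i\omega_1},\dots,e^{-i\omega_d})$, $\omega\in\mathbb{R}^d$; $\boldsymbol{1}=(1,\dots,1)$. Let $M\in\mathbb{Z}^{d\times d}$ be expansive (all eigenvalues have modulus strictly larger than $1$), $m=|\det M|$, and $G=2\pi M^{-T}\mathbb{Z}^d/2\pi\mathbb{Z}^d$, a finite abelian group of order $m$. For $p\in\mathbb{C}[T]$ and $\sigma\in G$, $p^\sigma\in\mathbb{C}[T]$ is defined by $p^\sigma(\boldsymbol{e}^{-i\omega})=p(\boldsymbol{e}^{-i(\omega+\sigma)})$, and $p^{\sigma*}=(p^\sigma)^*=(p^* )^\sigma$.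 $\delta_{\sigma,\tau}$ is the Kronecker delta. *)

theory Defs
  imports "HOL-Analysis.Analysis" "HOL-Library.Poly_Mapping" "HOL-Algebra.Coset"
begin

section \<open>Laurent polynomials\<close>

text \<open>
  The ring of complex Laurent polynomials in \<open>d = CARD('d)\<close> variables is the group ring of
  \<open>\<int>\<^sup>d\<close>: the coefficient of \<open>z\<^sup>k\<close> is \<^term>\<open>Poly_Mapping.lookup p k\<close>, and the library
  product on finitely supported functions is convolution with respect to addition of exponents.
\<close>

type_synonym 'd laurent = "(int ^ 'd) \<Rightarrow>\<^sub>0 complex"

definition laurent_eval :: "('d::finite) laurent \<Rightarrow> complex ^ 'd \<Rightarrow> complex" where
  "laurent_eval p z =
     (\<Sum>k\<in>Poly_Mapping.keys p. Poly_Mapping.lookup p k * (\<Prod>j\<in>UNIV. z $ j powi (k $ j)))"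

definition laurent_star :: "('d::finite) laurent \<Rightarrow> 'd laurent" where
  "laurent_star p =
     (\<Sum>k\<in>Poly_Mapping.keys p. Poly_Mapping.single (- k) (cnj (Poly_Mapping.lookup p k)))"

definition trig :: "('d::finite) laurent \<Rightarrow> real ^ 'd \<Rightarrow> complex" where
  "trig p \<omega> = laurent_eval p (\<chi> j. exp (- (\<i> * complex_of_real (\<omega> $ j))))"


section \<open>The dilation matrix and the group \<open>G\<close>\<close>

definition expansive :: "int ^ 'd ^ ('d::finite) \<Rightarrow> bool" where
  "expansive M \<longleftrightarrow>
     (\<forall>l::complex. (\<exists>v::complex ^ 'd. v \<noteq> 0 \<and> map_matrix of_int M *v v = l *s v) \<longrightarrow> cmod l > 1)"

definition real_vec :: "int ^ 'd \<Rightarrow> real ^ ('d::finite)" where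
  "real_vec k = (\<chi> j. real_of_int (k $ j))"

definition period_lattice :: "(real ^ ('d::finite)) set" where
  "period_lattice = range (\<lambda>k. (2 * pi) *\<^sub>R real_vec k)"

definition dilated_lattice :: "int ^ 'd ^ 'd \<Rightarrow> (real ^ ('d::finite)) set" where
  "dilated_lattice M =
     range (\<lambda>k. (2 * pi) *\<^sub>R (matrix_inv (transpose (map_matrix real_of_int M)) *v real_vec k))"

definition dilation_group :: "int ^ 'd ^ 'd \<Rightarrow> (real ^ ('d::finite)) set monoid" where
  "dilation_group M =
     \<lparr>carrier = dilated_lattice M, monoid.mult = (+), one = 0\<rparr> Mod period_lattice"

text \<open>
  For a coset \<open>S \<in> G\<close>, \<open>p\<^sup>S\<close> is the Laurent polynomial \<open>q\<close> with \<open>q(e\<^sup>-\<^sup>i\<^sup>\<omega>) = p(e\<^sup>-\<^sup>i\<^sup>(\<^sup>\<omega>\<^sup>+\<^sup>\<sigma>\<^sup>))\<close> for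
  any representative \<open>\<sigma>\<close> of \<open>S\<close>.  Existence, uniqueness and independence of the representative
  are proved at the end of the theory (\<open>twist_ex1\<close>).
\<close>

definition twist :: "('d::finite) laurent \<Rightarrow> (real ^ 'd) set \<Rightarrow> 'd laurent" where
  "twist p S = (THE q. \<forall>\<sigma>\<in>S. \<forall>\<omega>. trig q \<omega> = trig p (\<omega> + \<sigma>))"


section \<open>Well-definedness\<close>

lemma real_vec_inner: "real_vec k \<bullet> \<omega> = (\<Sum>j\<in>UNIV. real_of_int (k $ j) * \<omega> $ j)"
  by (simp add: real_vec_def inner_vec_def)

lemma trig_superset:
  fixes p :: "('d::finite) laurent"
  assumes "finite A" "Poly_Mapping.keys p \<subseteq> A"
  shows "trig p \<omega> = (\<Sum>k\<in>A. Poly_Mapping.lookup p k * cis (- (real_vec k \<bullet> \<omega>)))"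
proof -
  have mono: "(\<Prod>j\<in>UNIV. (exp (- (\<i> * complex_of_real (\<omega> $ j)))) powi (k $ j))
      = cis (- (real_vec k \<bullet> \<omega>))" for k :: "int ^ 'd"
  proof -
    have "(exp (- (\<i> * complex_of_real (\<omega> $ j)))) powi (k $ j)
        = exp (- (\<i> * complex_of_real (real_of_int (k $ j) * \<omega> $ j)))" for j
      by (simp add: exp_power_int mult_ac)
    then have "(\<Prod>j\<in>UNIV. (exp (- (\<i> * complex_of_real (\<omega> $ j)))) powi (k $ j))
        = exp (\<Sum>j\<in>UNIV. - (\<i> * complex_of_real (real_of_int (k $ j) * \<omega> $ j)))"
      by (simp add: exp_sum)
    also have "\<dots> = cis (- (real_vec k \<bullet> \<omega>))"
      by (simp add: real_vec_inner cis_conv_exp sum_negf sum_distrib_left)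
    finally show ?thesis .
  qed
  have "trig p \<omega>
      = (\<Sum>k\<in>Poly_Mapping.keys p. Poly_Mapping.lookup p k * cis (- (real_vec k \<bullet> \<omega>)))"
    by (simp add: trig_def laurent_eval_def mono)
  also have "\<dots> = (\<Sum>k\<in>A. Poly_Mapping.lookup p k * cis (- (real_vec k \<bullet> \<omega>)))"
    using assms by (intro sum.mono_neutral_left) (auto simp: in_keys_iff)
  finally show ?thesis .
qed

lemma characters_independent:
  fixes A :: "(int ^ ('d::finite)) set"
  assumes "finite A" "\<And>\<omega>. (\<Sum>k\<in>A. c k * cis (- (real_vec k \<bullet> \<omega>))) = 0" "k \<in> A"
  shows "c k = 0"
  using assms
proof (induction A arbitrary: c k rule: finite_induct)
  case empty
  then show ?case by simp
next
  case (insert a A)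
  let ?e = "\<lambda>k \<omega>. cis (- (real_vec k \<bullet> \<omega>))"
  have f: "c a * ?e a \<omega> + (\<Sum>k\<in>A. c k * ?e k \<omega>) = 0" for \<omega>
    using insert.prems(1)[of \<omega>] insert.hyps by simp
  have add: "?e k (\<omega> + \<theta>) = ?e k \<omega> * ?e k \<theta>" for k :: "int ^ 'd" and \<omega> \<theta>
    by (simp add: inner_add_right cis_mult add.commute)
  have van: "c b = 0" if b: "b \<in> A" for b
  proof -
    have "b \<noteq> a" using b insert.hyps by auto
    then obtain j where j: "b $ j \<noteq> a $ j" by (auto simp: vec_eq_iff)
    define \<theta> :: "real ^ 'd" where "\<theta> = axis j (pi / real_of_int (b $ j - a $ j))"
    have "(\<Sum>k\<in>A. (c k * (?e k \<theta> - ?e a \<theta>)) * ?e k \<omega>) = 0" for \<omega>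
    proof -
      have "(\<Sum>k\<in>A. (c k * (?e k \<theta> - ?e a \<theta>)) * ?e k \<omega>)
          = (\<Sum>k\<in>A. c k * ?e k (\<omega> + \<theta>)) - ?e a \<theta> * (\<Sum>k\<in>A. c k * ?e k \<omega>)"
        unfolding add by (simp add: sum_distrib_left sum_subtractf algebra_simps)
      also have "\<dots> = (c a * ?e a (\<omega> + \<theta>) + (\<Sum>k\<in>A. c k * ?e k (\<omega> + \<theta>)))
          - ?e a \<theta> * (c a * ?e a \<omega> + (\<Sum>k\<in>A. c k * ?e k \<omega>))"
        unfolding add by (simp add: algebra_simps)
      finally show ?thesis by (simp add: f)
    qed
    from insert.IH[OF this b] have "c b = 0 \<or> ?e b \<theta> = ?e a \<theta>" by simp
    moreover have "?e b \<theta> \<noteq> ?e a \<theta>"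
    proof
      assume "?e b \<theta> = ?e a \<theta>"
      then have "?e b \<theta> / ?e a \<theta> = 1" by simp
      then have "cis (- (real_vec b \<bullet> \<theta> - real_vec a \<bullet> \<theta>)) = 1"
        by (simp add: cis_divide)
      moreover have "real_vec b \<bullet> \<theta> - real_vec a \<bullet> \<theta> = pi"
      proof -
        have "real_vec b \<bullet> \<theta> - real_vec a \<bullet> \<theta>
            = (real_of_int (b $ j) - real_of_int (a $ j)) * (pi / (real_of_int (b $ j) - real_of_int (a $ j)))"
          by (simp add: \<theta>_def inner_axis real_vec_def diff_divide_distrib left_diff_distrib)
        then show ?thesis using j by simp
      qed
      ultimately show False by (simp add: complex_eq_iff)
    qed
    ultimately show ?thesis by simp
  qed
  then have "c a * ?e a 0 = 0" using f[of 0] by simp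
  then have "c a = 0" by simp
  with van insert.prems(2) show ?case by auto
qed

lemma trig_inject:
  fixes p q :: "('d::finite) laurent"
  assumes "\<And>\<omega>. trig p \<omega> = trig q \<omega>"
  shows "p = q"
proof (rule poly_mapping_eqI)
  fix k
  let ?A = "insert k (Poly_Mapping.keys p \<union> Poly_Mapping.keys q)"
  have "Poly_Mapping.lookup p k - Poly_Mapping.lookup q k = 0"
  proof (rule characters_independent[where A = ?A])
    fix \<omega>
    have "(\<Sum>k\<in>?A. (Poly_Mapping.lookup p k - Poly_Mapping.lookup q k) * cis (- (real_vec k \<bullet> \<omega>)))
        = trig p \<omega> - trig q \<omega>"
      by (subst (1 2) trig_superset[of ?A])
         (auto simp: left_diff_distrib sum_subtractf simp del: sum.insert)
    then show "(\<Sum>k\<in>?A. (Poly_Mapping.lookup p k - Poly_Mapping.lookup q k)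
        * cis (- (real_vec k \<bullet> \<omega>))) = 0"
      using assms by simp
  qed auto
  then show "Poly_Mapping.lookup p k = Poly_Mapping.lookup q k" by simp
qed

lemma lookup_laurent_star:
  "Poly_Mapping.lookup (laurent_star p) k = cnj (Poly_Mapping.lookup p (- k))"
proof -
  have "Poly_Mapping.lookup (laurent_star p) k
      = (\<Sum>l\<in>Poly_Mapping.keys p. if l = - k then cnj (Poly_Mapping.lookup p l) else 0)"
    unfolding laurent_star_def lookup_sum lookup_single
    by (intro sum.cong) (auto simp: when_def)
  also have "\<dots> = cnj (Poly_Mapping.lookup p (- k))"
    by (auto simp: sum.delta in_keys_iff)
  finally show ?thesis .
qed

lemma trig_laurent_star: "trig (laurent_star p) \<omega> = cnj (trig p \<omega>)"
proof -
  let ?A = "Poly_Mapping.keys p"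
  have "Poly_Mapping.keys (laurent_star p) \<subseteq> uminus ` ?A"
  proof
    fix k assume "k \<in> Poly_Mapping.keys (laurent_star p)"
    then have "- k \<in> ?A" by (simp add: in_keys_iff lookup_laurent_star)
    then show "k \<in> uminus ` ?A" by (metis imageI minus_minus)
  qed
  then have "trig (laurent_star p) \<omega> = (\<Sum>k\<in>uminus ` ?A.
      Poly_Mapping.lookup (laurent_star p) k * cis (- (real_vec k \<bullet> \<omega>)))"
    by (intro trig_superset) auto
  also have "\<dots> = (\<Sum>k\<in>?A. cnj (Poly_Mapping.lookup p k * cis (- (real_vec k \<bullet> \<omega>))))"
    by (subst sum.reindex)
       (auto simp: inj_on_def lookup_laurent_star cis_cnj real_vec_inner sum_negf)
  also have "\<dots> = cnj (trig p \<omega>)"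
    by (simp add: trig_superset[of ?A])
  finally show ?thesis .
qed

definition shift :: "('d::finite) laurent \<Rightarrow> real ^ 'd \<Rightarrow> 'd laurent" where
  "shift p \<sigma> = (\<Sum>k\<in>Poly_Mapping.keys p.
     Poly_Mapping.single k (Poly_Mapping.lookup p k * cis (- (real_vec k \<bullet> \<sigma>))))"

lemma lookup_shift:
  "Poly_Mapping.lookup (shift p \<sigma>) k = Poly_Mapping.lookup p k * cis (- (real_vec k \<bullet> \<sigma>))"
proof -
  have "Poly_Mapping.lookup (shift p \<sigma>) k = (\<Sum>l\<in>Poly_Mapping.keys p.
      if l = k then Poly_Mapping.lookup p l * cis (- (real_vec l \<bullet> \<sigma>)) else 0)"
    unfolding shift_def lookup_sum lookup_single
    by (intro sum.cong) (auto simp: when_def)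
  also have "\<dots> = Poly_Mapping.lookup p k * cis (- (real_vec k \<bullet> \<sigma>))"
    by (auto simp: sum.delta in_keys_iff)
  finally show ?thesis .
qed

lemma trig_shift: "trig (shift p \<sigma>) \<omega> = trig p (\<omega> + \<sigma>)"
proof -
  have "trig (shift p \<sigma>) \<omega> = (\<Sum>k\<in>Poly_Mapping.keys p.
      Poly_Mapping.lookup (shift p \<sigma>) k * cis (- (real_vec k \<bullet> \<omega>)))"
    by (intro trig_superset) (auto simp: in_keys_iff lookup_shift)
  also have "\<dots> = trig p (\<omega> + \<sigma>)"
    by (simp add: trig_superset[of "Poly_Mapping.keys p"] lookup_shift cis_mult
        inner_add_right mult.assoc add.commute)
  finally show ?thesis .
qed

lemma trig_periodic:
  assumes "\<kappa> \<in> period_lattice"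
  shows "trig p (\<omega> + \<kappa>) = trig p \<omega>"
proof -
  obtain l where l: "\<kappa> = (2 * pi) *\<^sub>R real_vec l"
    using assms by (auto simp: period_lattice_def)
  have "cis (- (real_vec k \<bullet> (\<omega> + \<kappa>))) = cis (- (real_vec k \<bullet> \<omega>))" for k
  proof -
    have "real_vec k \<bullet> \<kappa> = 2 * pi * real_of_int (\<Sum>j\<in>UNIV. k $ j * l $ j)"
      by (simp add: l real_vec_def inner_vec_def sum_distrib_left mult_ac)
    then have "cis (- (real_vec k \<bullet> \<kappa>)) = 1"
      using cis_multiple_2pi[of "- real_of_int (\<Sum>j\<in>UNIV. k $ j * l $ j)"]
      by (simp del: of_int_sum)
    moreover have "cis (- (real_vec k \<bullet> (\<omega> + \<kappa>)))
        = cis (- (real_vec k \<bullet> \<omega>)) * cis (- (real_vec k \<bullet> \<kappa>))"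
      by (simp add: cis_mult inner_add_right)
    ultimately show ?thesis by simp
  qed
  then show ?thesis by (simp add: trig_superset[of "Poly_Mapping.keys p"])
qed

lemma dilation_group_coset:
  assumes "S \<in> carrier (dilation_group M)"
  obtains \<tau> where "\<tau> \<in> dilated_lattice M" "S = (\<lambda>\<kappa>. \<tau> + \<kappa>) ` period_lattice"
  using assms
  by (force simp: dilation_group_def carrier_FactGroup r_coset_def add.commute)

lemma twist_ex1:
  assumes "S \<in> carrier (dilation_group M)"
  shows "\<exists>!q. \<forall>\<sigma>\<in>S. \<forall>\<omega>. trig q \<omega> = trig p (\<omega> + \<sigma>)"
proof -
  obtain \<tau> where S: "S = (\<lambda>\<kappa>. \<tau> + \<kappa>) ` period_lattice"
    using assms by (rule dilation_group_coset)
  have 0: "0 \<in> (period_lattice :: (real ^ 'a) set)"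
    by (auto simp: period_lattice_def real_vec_def vec_eq_iff intro!: image_eqI[of _ _ 0])
  have "trig (shift p \<tau>) \<omega> = trig p (\<omega> + \<sigma>)" if "\<sigma> \<in> S" for \<sigma> \<omega>
    using that by (auto simp: S trig_shift trig_periodic add.assoc[symmetric])
  moreover have "q = q'"
    if "\<forall>\<sigma>\<in>S. \<forall>\<omega>. trig q \<omega> = trig p (\<omega> + \<sigma>)" "\<forall>\<sigma>\<in>S. \<forall>\<omega>. trig q' \<omega> = trig p (\<omega> + \<sigma>)" for q q'
  proof (rule trig_inject)
    have "\<tau> \<in> S" using 0 by (force simp: S)
    with that show "trig q \<omega> = trig q' \<omega>" for \<omega> by simp
  qed
  ultimately show ?thesis by blast
qed

lemma twist_eq_shift:
  assumes "S \<in> carrier (dilation_group M)" "\<sigma> \<in> S"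
  shows "twist p S = shift p \<sigma>"
proof (rule trig_inject)
  show "trig (twist p S) \<omega> = trig (shift p \<sigma>) \<omega>" for \<omega>
    using theI'[OF twist_ex1[OF assms(1), of p], folded twist_def] assms(2)
    by (simp add: trig_shift)
qed

end

theory Submission
  imports Defs
begin

text \<open>
  The equivalence is pure algebra once two facts about the action of \<open>G\<close> on Laurent polynomials
  are known: \<open>G\<close> is a finite group that acts by ring automorphisms commuting with the involution,
  and there are finitely many Laurent polynomials \<open>a\<^sub>k\<close> with
  \<open>\<Sum>\<^sub>k a\<^sub>k\<^sup>\<sigma>\<^sup>* a\<^sub>k\<^sup>\<tau> = \<delta>\<^sub>\<sigma>\<^sub>\<tau>\<close>, that is, the identity matrix has a factorization of the kind asked for in
  (ii).  Call such a family a frame.  Write \<open>f = 1 - \<Sum>\<^sub>\<sigma> p\<^sup>\<sigma>\<^sup>* p\<^sup>\<sigma>\<close> for the left side of (i), and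
  \<open>A\<close> for the matrix with entries \<open>\<delta>\<^sub>\<sigma>\<^sub>\<tau> - p\<^sup>\<sigma>\<^sup>* p\<^sup>\<tau>\<close>.

  From (ii) to (i): evaluating the hermitian form \<open>A\<close> at the vector \<open>(p\<^sup>\<sigma>)\<^sub>\<sigma>\<close> gives \<open>(1 - f) f\<close>, so
  \<open>f = f\<^sup>* f + (1 - f) f\<close> is a sum of hermitian squares whenever \<open>A\<close> is factorized
  (\<open>sum_of_squares_of_matrix_factorization\<close>).

  From (i) to (ii): the matrix identity \<open>A = A\<^sup>2 + (p\<^sup>\<sigma>\<^sup>* p\<^sup>\<tau> f)\<^sub>\<sigma>\<^sub>\<tau>\<close> holds.  Applying \<open>A\<close> to the frame
  factorizes \<open>A\<^sup>2\<close> by the elements \<open>a\<^sub>k - p b\<^sub>k\<close> with \<open>b\<^sub>k = \<Sum>\<^sub>\<rho> p\<^sup>\<rho>\<^sup>* a\<^sub>k\<^sup>\<rho>\<close>.  The second summand is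
  factorized by the elements \<open>p g\<close> as soon as \<open>f\<close> is a sum of squares \<open>g\<^sup>* g\<close> of \<open>G\<close>-invariant
  elements.  Such a representation comes from an arbitrary one by averaging: if
  \<open>f = \<Sum>\<^sub>j h\<^sub>j\<^sup>* h\<^sub>j\<close>, the Parseval identity for the frame turns \<open>|G| f = \<Sum>\<^sub>j \<Sum>\<^sub>\<rho> (h\<^sub>j\<^sup>* h\<^sub>j)\<^sup>\<rho>\<close> into
  the sum of the squares of the invariant elements \<open>\<Sum>\<^sub>\<rho> h\<^sub>j\<^sup>\<rho>\<^sup>* a\<^sub>k\<^sup>\<rho>\<close>
  (\<open>invariant_sum_of_squares\<close>, \<open>matrix_factorization_of_sum_of_squares\<close>).

  For the frame, let \<open>n\<close> be a positive integer with \<open>n \<sigma> \<in> 2\<pi>\<int>\<^sup>d\<close> for all \<open>\<sigma> \<in> 2\<pi>M\<^sup>-\<^sup>T\<int>\<^sup>d\<close>;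
  Cramer's rule shows that \<open>n = |det M|\<close> qualifies.  The monomials \<open>z\<^sup>k\<close> with \<open>k \<in> {0..<n}\<^sup>d\<close>,
  divided by \<open>\<surd>(n\<^sup>d)\<close>, form a frame, because the sum of the character \<open>k \<mapsto> e\<^sup>-\<^sup>i\<^sup>k\<^sup>\<theta>\<close> over this box is a
  product of \<open>d\<close> geometric sums of \<open>n\<close>-th roots of unity (\<open>character_sum_over_box\<close>).
\<close>

section \<open>Finite groups acting on rings with involution\<close>

lemma sum_reindex_from_1:
  fixes f :: "'a \<Rightarrow> 'c"
  assumes "finite I"
  shows "\<exists>(N::nat) g. \<forall>F. (\<Sum>j=1..N. F (g j)) = (\<Sum>i\<in>I. F (f i) :: 'b::comm_monoid_add)"
proof -
  obtain e where e: "bij_betw e {1..card I} I"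
    using ex_bij_betw_nat_finite_1[OF assms] by blast
  have "(\<Sum>j=1..card I. F (f (e j))) = (\<Sum>i\<in>I. F (f i))" for F :: "'c \<Rightarrow> 'b"
    using sum.reindex_bij_betw[OF e, of "\<lambda>i. F (f i)"] by simp
  then show ?thesis by (intro exI[of _ "card I"] exI[of _ "\<lambda>j. f (e j)"]) blast
qed

text \<open>
  The algebra behind the equivalence: a commutative ring with involution on which a finite group
  acts from the right by automorphisms that respect the involution.
\<close>

locale star_action = group G for G :: "('g, 'b) monoid_scheme" (structure) +
  fixes star :: "'r::comm_ring_1 \<Rightarrow> 'r" and act :: "'r \<Rightarrow> 'g \<Rightarrow> 'r"
  assumes finite_carrier: "finite (carrier G)"
    and star_add: "star (x + y) = star x + star y"
    and star_mult: "star (x * y) = star x * star y"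
    and star_star: "star (star x) = x"
    and act_add: "\<sigma> \<in> carrier G \<Longrightarrow> act (x + y) \<sigma> = act x \<sigma> + act y \<sigma>"
    and act_mult: "\<sigma> \<in> carrier G \<Longrightarrow> act (x * y) \<sigma> = act x \<sigma> * act y \<sigma>"
    and act_star: "\<sigma> \<in> carrier G \<Longrightarrow> act (star x) \<sigma> = star (act x \<sigma>)"
    and act_one: "act x \<one> = x"
    and act_act: "\<sigma> \<in> carrier G \<Longrightarrow> \<tau> \<in> carrier G \<Longrightarrow> act (act x \<sigma>) \<tau> = act x (\<sigma> \<otimes> \<tau>)"
begin

lemma star_0: "star 0 = 0"
  using star_add[of 0 0] by simp

lemma star_1: "star 1 = 1"
  using star_mult[of "star 1" 1] by (simp add: star_star)

lemma star_minus: "star (- x) = - star x"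
  using star_add[of x "- x"] by (simp add: star_0 eq_neg_iff_add_eq_0 add.commute)

lemma star_diff: "star (x - y) = star x - star y"
  using star_add[of x "- y"] by (simp add: star_minus)

lemma star_sum: "star (sum f A) = (\<Sum>i\<in>A. star (f i))"
  by (induction A rule: infinite_finite_induct) (simp_all add: star_0 star_add)

lemma act_0: "\<sigma> \<in> carrier G \<Longrightarrow> act 0 \<sigma> = 0"
  using act_add[of \<sigma> 0 0] by simp

lemma act_1:
  assumes "\<sigma> \<in> carrier G"
  shows "act 1 \<sigma> = 1"
proof -
  have "act (act 1 (inv \<sigma>)) \<sigma> = 1"
    using assms by (simp add: act_act act_one)
  then show ?thesis
    using act_mult[OF assms, of "act 1 (inv \<sigma>)" 1] by simp
qed

lemma act_minus: "\<sigma> \<in> carrier G \<Longrightarrow> act (- x) \<sigma> = - act x \<sigma>"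
  using act_add[of \<sigma> x "- x"] by (simp add: act_0 eq_neg_iff_add_eq_0 add.commute)

lemma act_diff: "\<sigma> \<in> carrier G \<Longrightarrow> act (x - y) \<sigma> = act x \<sigma> - act y \<sigma>"
  using act_add[of \<sigma> x "- y"] by (simp add: act_minus)

lemma act_sum: "\<sigma> \<in> carrier G \<Longrightarrow> act (sum f A) \<sigma> = (\<Sum>i\<in>A. act (f i) \<sigma>)"
  by (induction A rule: infinite_finite_induct) (simp_all add: act_0 act_add)

definition trace :: "'r \<Rightarrow> 'r" where
  "trace x = (\<Sum>\<rho>\<in>carrier G. act x \<rho>)"

lemma act_trace:
  assumes "\<sigma> \<in> carrier G"
  shows "act (trace x) \<sigma> = trace x"
proof -
  have "act (trace x) \<sigma> = (\<Sum>\<rho>\<in>carrier G. act x (\<rho> \<otimes> \<sigma>))"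
    using assms by (simp add: trace_def act_sum act_act)
  also have "\<dots> = (\<Sum>\<rho>\<in>carrier G. act x \<rho>)"
    by (rule sum.reindex_bij_witness[where i = "\<lambda>\<rho>. \<rho> \<otimes> inv \<sigma>" and j = "\<lambda>\<rho>. \<rho> \<otimes> \<sigma>"])
       (use assms in \<open>auto simp: m_assoc\<close>)
  finally show ?thesis by (simp add: trace_def)
qed

text \<open>
  The left side of (i); writing it with \<^term>\<open>trace\<close> makes its invariance under the group evident.
\<close>

definition defect :: "'r \<Rightarrow> 'r" where
  "defect p = 1 - trace (star p * p)"

lemma defect_eq: "defect p = 1 - (\<Sum>\<sigma>\<in>carrier G. star (act p \<sigma>) * act p \<sigma>)"
  by (simp add: defect_def trace_def act_mult act_star)

lemma star_defect: "star (defect p) = defect p"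
  by (simp add: defect_eq star_diff star_1 star_sum star_mult star_star mult.commute)

lemma act_defect: "\<sigma> \<in> carrier G \<Longrightarrow> act (defect p) \<sigma> = defect p"
  by (simp add: defect_def act_diff act_1 act_trace)

text \<open>
  With \<open>s = 1 - f\<close>, the form of the matrix at the vector of all \<open>p\<^sup>\<sigma>\<close> has the value \<open>s - s\<^sup>2\<close>, and the
  factorization exhibits this value as \<open>\<Sum>\<^sub>j g\<^sub>j\<^sup>* g\<^sub>j\<close>.  Adding \<open>f\<^sup>* f = (1 - s)\<^sup>2\<close> gives \<open>1 - s = f\<close>.
\<close>

lemma sum_of_squares_of_matrix_factorization:
  fixes q :: "nat \<Rightarrow> 'r"
  assumes fac: "\<And>\<sigma> \<tau>. \<sigma> \<in> carrier G \<Longrightarrow> \<tau> \<in> carrier G \<Longrightarrow>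
    (if \<sigma> = \<tau> then 1 else 0) - star (act p \<sigma>) * act p \<tau>
      = (\<Sum>j=1..N. star (act (q j) \<sigma>) * act (q j) \<tau>)"
  shows "\<exists>(r::nat) h. defect p = (\<Sum>j=1..r. star (h j) * h j)"
proof -
  let ?G = "carrier G"
  define s where "s = (\<Sum>\<sigma>\<in>?G. star (act p \<sigma>) * act p \<sigma>)"
  define g where "g j = (\<Sum>\<tau>\<in>?G. act (q j) \<tau> * star (act p \<tau>))" for j
  have "(\<Sum>j=1..N. star (g j) * g j)
      = (\<Sum>j=1..N. \<Sum>\<sigma>\<in>?G. \<Sum>\<tau>\<in>?G.
          act p \<sigma> * star (act p \<tau>) * (star (act (q j) \<sigma>) * act (q j) \<tau>))"
    by (simp add: g_def star_sum star_mult star_star sum_product mult_ac)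
  also have "\<dots> = (\<Sum>\<sigma>\<in>?G. \<Sum>\<tau>\<in>?G. act p \<sigma> * star (act p \<tau>) *
          (\<Sum>j=1..N. star (act (q j) \<sigma>) * act (q j) \<tau>))"
    unfolding sum_distrib_left by (subst sum.swap, intro sum.cong refl) (rule sum.swap)
  also have "\<dots> = (\<Sum>\<sigma>\<in>?G. \<Sum>\<tau>\<in>?G. act p \<sigma> * star (act p \<tau>) *
          ((if \<sigma> = \<tau> then 1 else 0) - star (act p \<sigma>) * act p \<tau>))"
    by (intro sum.cong) (simp_all add: fac)
  also have "\<dots> = (\<Sum>\<sigma>\<in>?G. \<Sum>\<tau>\<in>?G. (if \<sigma> = \<tau> then act p \<sigma> * star (act p \<tau>) else 0)
          - (star (act p \<sigma>) * act p \<sigma>) * (star (act p \<tau>) * act p \<tau>))"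
    by (intro sum.cong) (simp_all add: algebra_simps)
  also have "\<dots> = s - s * s"
    by (simp add: sum_subtractf finite_carrier s_def sum_product mult.commute)
  finally have g: "(\<Sum>j=1..N. star (g j) * g j) = s - s * s" .
  have f: "defect p = 1 - s" by (simp add: defect_eq s_def)
  \<comment> \<open>The \<open>g j\<close> are numbered from 1, so index 0 can carry the extra square \<open>f\<^sup>* f\<close>.\<close>
  define h where "h i = (if i = 0 then defect p else g i)" for i
  have "(\<Sum>i\<in>{0..N}. star (h i) * h i) = star (h 0) * h 0 + (\<Sum>i=1..N. star (h i) * h i)"
    by (simp add: sum.atLeast_Suc_atMost)
  also have "\<dots> = star (defect p) * defect p + (\<Sum>j=1..N. star (g j) * g j)"
    by (simp add: h_def)
  also have "\<dots> = defect p"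
    unfolding g star_defect by (simp add: f algebra_simps)
  finally have h: "(\<Sum>i\<in>{0..N}. star (h i) * h i) = defect p" .
  obtain r :: nat and h' where h':
    "\<forall>F. (\<Sum>j=1..r. F (h' j)) = (\<Sum>i\<in>{0..N}. F (h i) :: 'r)"
    using sum_reindex_from_1[of "{0..N}" h] by blast
  show ?thesis
    using h spec[OF h', of "\<lambda>x. star x * x"] by (intro exI[of _ r] exI[of _ h']) simp
qed

end

text \<open>
  A frame factorizes the identity matrix.  The element \<open>c\<close> is an invariant of squared modulus
  \<open>1 / |G|\<close>, which absorbs the factor \<open>|G|\<close> that averaging over the group produces.
\<close>

locale framed_star_action = star_action G star act
  for G :: "('g, 'b) monoid_scheme" (structure)
    and star :: "'r::comm_ring_1 \<Rightarrow> 'r" and act :: "'r \<Rightarrow> 'g \<Rightarrow> 'r" +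
  fixes K :: "'k set" and a :: "'k \<Rightarrow> 'r" and c :: 'r
  assumes finite_frame: "finite K"
    and frame: "\<sigma> \<in> carrier G \<Longrightarrow> \<tau> \<in> carrier G \<Longrightarrow>
      (\<Sum>k\<in>K. star (act (a k) \<sigma>) * act (a k) \<tau>) = (if \<sigma> = \<tau> then 1 else 0)"
    and act_c: "\<sigma> \<in> carrier G \<Longrightarrow> act c \<sigma> = c"
    and norm_c: "star c * c * of_nat (card (carrier G)) = 1"
begin

text \<open>
  Contracting the frame identity with the vector of all \<open>p\<^sup>\<rho>\<^sup>*\<close> picks out the component at \<open>\<sigma>\<close>: the
  frame reconstructs \<open>p\<close> from its coefficients \<open>trace (p\<^sup>* a\<^sub>k)\<close>.
\<close>

lemma frame_expansion:
  assumes "\<sigma> \<in> carrier G"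
  shows "(\<Sum>k\<in>K. star (act (a k) \<sigma>) * trace (star p * a k)) = star (act p \<sigma>)"
proof -
  have "(\<Sum>k\<in>K. star (act (a k) \<sigma>) * trace (star p * a k))
      = (\<Sum>\<rho>\<in>carrier G. star (act p \<rho>) * (\<Sum>k\<in>K. star (act (a k) \<sigma>) * act (a k) \<rho>))"
    by (simp add: trace_def act_mult act_star sum_distrib_left mult_ac) (rule sum.swap)
  also have "\<dots> = (\<Sum>\<rho>\<in>carrier G. if \<sigma> = \<rho> then star (act p \<rho>) else 0)"
    using assms by (intro sum.cong) (simp_all add: frame)
  also have "\<dots> = star (act p \<sigma>)"
    using assms by (simp add: finite_carrier)
  finally show ?thesis .
qed

lemma frame_parseval:
  "(\<Sum>k\<in>K. star (trace (star p * a k)) * trace (star p * a k)) = trace (star p * p)"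
proof -
  have "star (trace (star p * a k)) = (\<Sum>\<rho>\<in>carrier G. act p \<rho> * star (act (a k) \<rho>))" for k
    by (simp add: trace_def act_mult act_star star_sum star_mult star_star)
  then have "(\<Sum>k\<in>K. star (trace (star p * a k)) * trace (star p * a k))
      = (\<Sum>k\<in>K. \<Sum>\<rho>\<in>carrier G. act p \<rho> * (star (act (a k) \<rho>) * trace (star p * a k)))"
    by (simp add: sum_distrib_right mult.assoc)
  also have "\<dots> = (\<Sum>\<rho>\<in>carrier G. act p \<rho> * (\<Sum>k\<in>K. star (act (a k) \<rho>) * trace (star p * a k)))"
    by (subst sum.swap) (simp add: sum_distrib_left)
  also have "\<dots> = trace (star p * p)"
    by (simp add: frame_expansion trace_def[of "star p * p"] act_mult act_star)
       (simp add: mult.commute)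
  finally show ?thesis .
qed

text \<open>
  Averaging replaces each \<open>h\<^sub>j\<close> by its frame coefficients, which are traces and hence invariant.  No
  square is lost on the way, by Parseval's identity.
\<close>

lemma invariant_sum_of_squares:
  fixes h :: "nat \<Rightarrow> 'r"
  assumes f: "f = (\<Sum>j=1..r. star (h j) * h j)"
    and inv: "\<And>\<sigma>. \<sigma> \<in> carrier G \<Longrightarrow> act f \<sigma> = f"
  defines "g \<equiv> \<lambda>(j, k). c * trace (star (h j) * a k)"
  shows "f = (\<Sum>i\<in>{1..r} \<times> K. star (g i) * g i)"
proof -
  have "(\<Sum>i\<in>{1..r} \<times> K. star (g i) * g i) = (\<Sum>j=1..r. \<Sum>k\<in>K. star (g (j, k)) * g (j, k))"
    by (simp add: sum.cartesian_product)
  also have "\<dots> = (\<Sum>j=1..r. star c * c * (\<Sum>k\<in>K.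
      star (trace (star (h j) * a k)) * trace (star (h j) * a k)))"
    by (simp add: g_def star_mult sum_distrib_left mult_ac)
  also have "\<dots> = star c * c * (\<Sum>j=1..r. trace (star (h j) * h j))"
    by (simp add: frame_parseval sum_distrib_left)
  also have "(\<Sum>j=1..r. trace (star (h j) * h j)) = trace f"
    unfolding trace_def f by (subst sum.swap) (simp add: act_sum)
  also have "trace f = of_nat (card (carrier G)) * f"
    by (simp add: trace_def inv)
  also have "star c * c * (of_nat (card (carrier G)) * f) = f"
    using norm_c by (simp add: mult.assoc[symmetric])
  finally show ?thesis by simp
qed

text \<open>
  The elements \<open>a\<^sub>k - p b\<^sub>k\<close> factorize the square of the matrix, which differs from the matrix by
  \<open>p\<^sup>\<sigma>\<^sup>* p\<^sup>\<tau> f\<close>; invariant summands \<open>g\<^sup>* g\<close> of \<open>f\<close> make up for this difference with the elements \<open>p g\<close>,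
  since \<open>(p g)\<^sup>\<sigma> = p\<^sup>\<sigma> g\<close>.
\<close>

lemma matrix_factorization_of_sum_of_squares:
  fixes h :: "nat \<Rightarrow> 'r"
  assumes h: "defect p = (\<Sum>j=1..r. star (h j) * h j)"
  shows "\<exists>(N::nat) q. \<forall>\<sigma>\<in>carrier G. \<forall>\<tau>\<in>carrier G.
    (if \<sigma> = \<tau> then 1 else 0) - star (act p \<sigma>) * act p \<tau>
      = (\<Sum>j=1..N. star (act (q j) \<sigma>) * act (q j) \<tau>)"
proof -
  define g where "g = (\<lambda>(j, k). c * trace (star (h j) * a k))"
  define b where "b k = trace (star p * a k)" for k
  define u where "u = case_sum (\<lambda>k. a k - p * b k) (\<lambda>i. p * g i)"
  let ?I = "K <+> ({1..r} \<times> K)"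
  have g_inv: "act (g i) \<sigma> = g i" if "\<sigma> \<in> carrier G" for i \<sigma>
    using that by (cases i) (simp add: g_def act_mult act_c act_trace)
  have b_inv: "act (b k) \<sigma> = b k" if "\<sigma> \<in> carrier G" for k \<sigma>
    using that by (simp add: b_def act_trace)
  have u: "(if \<sigma> = \<tau> then 1 else 0) - star (act p \<sigma>) * act p \<tau>
      = (\<Sum>i\<in>?I. star (act (u i) \<sigma>) * act (u i) \<tau>)"
    if st: "\<sigma> \<in> carrier G" "\<tau> \<in> carrier G" for \<sigma> \<tau>
  proof -
    let ?P = "star (act p \<sigma>) * act p \<tau>"
    have "(\<Sum>k\<in>K. star (act (u (Inl k)) \<sigma>) * act (u (Inl k)) \<tau>)
        = (\<Sum>k\<in>K. star (act (a k) \<sigma>) * act (a k) \<tau>)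
          - act p \<tau> * (\<Sum>k\<in>K. star (act (a k) \<sigma>) * b k)
          - star (act p \<sigma>) * star (\<Sum>k\<in>K. star (act (a k) \<tau>) * b k)
          + ?P * (\<Sum>k\<in>K. star (b k) * b k)"
      using st by (simp add: u_def act_diff act_mult b_inv star_diff star_mult star_sum star_star
          sum_distrib_left sum_subtractf sum.distrib algebra_simps)
    also have "\<dots> = (if \<sigma> = \<tau> then 1 else 0) - ?P - ?P * defect p"
      using st unfolding b_def frame_expansion[OF st(1)] frame_expansion[OF st(2)] frame_parseval
        frame[OF st]
      by (simp add: star_star defect_def algebra_simps)
    finally have 1: "(\<Sum>k\<in>K. star (act (u (Inl k)) \<sigma>) * act (u (Inl k)) \<tau>)
        = (if \<sigma> = \<tau> then 1 else 0) - ?P - ?P * defect p" .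
    have "(\<Sum>i\<in>{1..r} \<times> K. star (act (u (Inr i)) \<sigma>) * act (u (Inr i)) \<tau>)
        = ?P * (\<Sum>i\<in>{1..r} \<times> K. star (g i) * g i)"
      using st by (simp add: u_def act_mult star_mult g_inv sum_distrib_left mult_ac)
    also have "(\<Sum>i\<in>{1..r} \<times> K. star (g i) * g i) = defect p"
      unfolding g_def by (rule invariant_sum_of_squares[OF h act_defect, symmetric])
    finally show ?thesis
      using 1 by (simp add: sum.Plus finite_frame)
  qed
  obtain N :: nat and q where q:
    "\<forall>F. (\<Sum>j=1..N. F (q j)) = (\<Sum>i\<in>?I. F (u i) :: 'r)"
    using sum_reindex_from_1[of ?I u] finite_frame by auto
  have "(\<Sum>j=1..N. star (act (q j) \<sigma>) * act (q j) \<tau>)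
      = (\<Sum>i\<in>?I. star (act (u i) \<sigma>) * act (u i) \<tau>)" for \<sigma> \<tau>
    using spec[OF q, of "\<lambda>x. star (act x \<sigma>) * act x \<tau>"] .
  then show ?thesis
    using u by (intro exI[of _ N] exI[of _ q]) simp
qed

end


section \<open>Laurent polynomials as trigonometric polynomials\<close>

lemma real_vec_add: "real_vec (k + l) = real_vec k + real_vec l"
  by (simp add: real_vec_def vec_eq_iff)

lemma real_vec_uminus: "real_vec (- k) = - real_vec k"
  by (simp add: real_vec_def vec_eq_iff)

lemma real_vec_0: "real_vec 0 = 0"
  by (simp add: real_vec_def vec_eq_iff)

lemma trig_single: "trig (Poly_Mapping.single k c) \<omega> = c * cis (- (real_vec k \<bullet> \<omega>))"
  by (subst trig_superset[of "{k}"]) auto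

lemma trig_add: "trig (p + q) \<omega> = trig p \<omega> + trig q \<omega>"
proof -
  let ?A = "Poly_Mapping.keys p \<union> Poly_Mapping.keys q"
  have "trig (p + q) \<omega> = (\<Sum>k\<in>?A. Poly_Mapping.lookup (p + q) k * cis (- (real_vec k \<bullet> \<omega>)))"
    by (rule trig_superset) (simp_all add: Poly_Mapping.keys_add)
  also have "\<dots> = trig p \<omega> + trig q \<omega>"
    by (simp add: trig_superset[of ?A] lookup_add distrib_right sum.distrib)
  finally show ?thesis .
qed

lemma trig_sum:
  fixes f :: "'b \<Rightarrow> ('d::finite) laurent"
  shows "trig (sum f A) \<omega> = (\<Sum>i\<in>A. trig (f i) \<omega>)"
proof -
  have "trig (0 :: 'd laurent) \<omega> = 0"
    using trig_add[of 0 0 \<omega>] by simp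
  then show ?thesis
    by (induction A rule: infinite_finite_induct) (simp_all add: trig_add)
qed

lemma sum_of_monomials:
  "p = (\<Sum>k\<in>Poly_Mapping.keys p. Poly_Mapping.single k (Poly_Mapping.lookup p k))"
  by (rule poly_mapping_eqI)
     (auto simp: lookup_sum lookup_single when_def sum.delta' in_keys_iff)

lemma trig_mult: "trig (p * q) \<omega> = trig p \<omega> * trig q \<omega>"
proof -
  let ?m = "\<lambda>p k. Poly_Mapping.single k (Poly_Mapping.lookup p k) :: 'a laurent"
  have product_term: "trig (Poly_Mapping.single (k + l) (b * c)) \<omega>
      = trig (Poly_Mapping.single k b) \<omega> * trig (Poly_Mapping.single l c) \<omega>"
    for k l :: "int ^ 'a" and b c
  proof -
    have "cis (- (real_vec (k + l) \<bullet> \<omega>))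
        = cis (- (real_vec k \<bullet> \<omega>)) * cis (- (real_vec l \<bullet> \<omega>))"
      by (simp add: real_vec_add inner_add_left cis_mult add.commute)
    then show ?thesis by (simp add: trig_single)
  qed
  have expand: "trig r \<omega> = (\<Sum>k\<in>Poly_Mapping.keys r. trig (?m r k) \<omega>)" for r :: "'a laurent"
    using arg_cong[OF sum_of_monomials[of r], of "\<lambda>r. trig r \<omega>"] by (simp only: trig_sum)
  have "p * q = (\<Sum>k\<in>Poly_Mapping.keys p. \<Sum>l\<in>Poly_Mapping.keys q. ?m p k * ?m q l)"
    using arg_cong2[OF sum_of_monomials[of p] sum_of_monomials[of q], of "(*)"]
    by (simp only: sum_product)
  then have "trig (p * q) \<omega> = (\<Sum>k\<in>Poly_Mapping.keys p. \<Sum>l\<in>Poly_Mapping.keys q.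
      trig (?m p k) \<omega> * trig (?m q l) \<omega>)"
    by (simp only: trig_sum mult_single product_term)
  also have "\<dots> = trig p \<omega> * trig q \<omega>"
    unfolding expand[of p] expand[of q] by (rule sum_product[symmetric])
  finally show ?thesis .
qed

lemma shift_add: "shift (p + q) \<sigma> = shift p \<sigma> + shift q \<sigma>"
  by (rule trig_inject) (simp add: trig_shift trig_add)

lemma shift_mult: "shift (p * q) \<sigma> = shift p \<sigma> * shift q \<sigma>"
  by (rule trig_inject) (simp add: trig_shift trig_mult)

lemma shift_star: "shift (laurent_star p) \<sigma> = laurent_star (shift p \<sigma>)"
  by (rule trig_inject) (simp add: trig_shift trig_laurent_star)

lemma shift_shift: "shift (shift p \<sigma>) \<tau> = shift p (\<sigma> + \<tau>)"
  by (rule trig_inject) (simp add: trig_shift add_ac)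

lemma shift_0: "shift p 0 = p"
  by (rule trig_inject) (simp add: trig_shift)

section \<open>The dual lattice and its quotient\<close>

lemma matrix_inv_inverse:
  fixes A :: "real ^ 'n ^ 'n"
  assumes "det A \<noteq> 0"
  shows "A ** matrix_inv A = mat 1" "matrix_inv A ** A = mat 1"
proof -
  have "\<exists>A'. A ** A' = mat 1 \<and> A' ** A = mat 1"
    using assms by (simp add: invertible_det_nz[symmetric] invertible_def)
  then have "A ** matrix_inv A = mat 1 \<and> matrix_inv A ** A = mat 1"
    unfolding matrix_inv_def by (rule someI_ex)
  then show "A ** matrix_inv A = mat 1" "matrix_inv A ** A = mat 1" by simp_all
qed

text \<open>
  Zero cannot be an eigenvalue of an expansive matrix.  A real kernel vector of \<open>M\<close>, read as a complex
  vector, would be an eigenvector for it.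
\<close>

lemma expansive_det_nonzero:
  fixes M :: "int ^ 'd ^ ('d::finite)"
  assumes "expansive M"
  shows "det (transpose (map_matrix real_of_int M)) \<noteq> 0"
proof
  let ?A = "map_matrix real_of_int M"
  assume "det (transpose ?A) = 0"
  then have "\<not> invertible ?A" by (simp add: invertible_det_nz)
  then obtain x where x: "x \<noteq> 0" "?A *v x = 0"
    by (metis invertible_left_inverse matrix_left_invertible_ker)
  define v :: "complex ^ 'd" where "v = (\<chi> j. complex_of_real (x $ j))"
  have "(map_matrix of_int M *v v) $ i = complex_of_real ((?A *v x) $ i)" for i
    by (simp add: v_def matrix_vector_mult_def map_matrix_def)
  then have "map_matrix of_int M *v v = 0 *s v"
    using x(2) by (simp add: vec_eq_iff)
  moreover have "v \<noteq> 0"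
    using x(1) by (auto simp: v_def vec_eq_iff)
  ultimately have "cmod 0 > 1"
    using assms unfolding expansive_def by blast
  then show False by simp
qed

text \<open>
  With \<open>n = |det M|\<close>, Cramer's rule writes each coordinate of \<open>M\<^sup>-\<^sup>T k\<close> as the determinant of an integer
  matrix divided by \<open>\<plusminus>n\<close>.  This single integer \<open>n\<close> serves twice below: it bounds the number of cosets,
  and it is the side length of the box of exponents in the frame.
\<close>

lemma dilated_lattice_torsion:
  fixes M :: "int ^ 'd ^ ('d::finite)"
  assumes "expansive M"
  obtains n :: nat where "n > 0"
    "\<And>\<sigma>. \<sigma> \<in> dilated_lattice M \<Longrightarrow> \<exists>l. \<sigma> = (2 * pi / real n) *\<^sub>R real_vec l"
proof -
  let ?B = "transpose (map_matrix real_of_int M)"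
  have nz: "det ?B \<noteq> 0" by (rule expansive_det_nonzero[OF assms])
  have int_det: "det A \<in> \<int>" if "\<And>i j. A $ i $ j \<in> \<int>" for A :: "real ^ 'd ^ 'd"
    unfolding det_def by (intro Ints_sum Ints_mult Ints_prod) (use that in auto)
  have B_int: "?B $ i $ j \<in> \<int>" for i j
    by (simp add: transpose_def map_matrix_def)
  obtain D :: int where D: "det ?B = real_of_int D"
    using int_det[OF B_int] by (auto elim: Ints_cases)
  define n where "n = nat \<bar>D\<bar>"
  have n: "n > 0" "real n = \<bar>det ?B\<bar>"
    using nz unfolding D by (simp_all add: n_def)
  have "\<exists>l. \<sigma> = (2 * pi / real n) *\<^sub>R real_vec l" if \<sigma>: "\<sigma> \<in> dilated_lattice M" for \<sigma>
  proof -
    obtain k where k: "\<sigma> = (2 * pi) *\<^sub>R (matrix_inv ?B *v real_vec k)"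
      using \<sigma> unfolding dilated_lattice_def by blast
    let ?x = "matrix_inv ?B *v real_vec k"
    have "?B ** matrix_inv ?B = mat 1"
      by (rule matrix_inv_inverse(1)[OF nz])
    then have "?B *v ?x = real_vec k"
      by (simp add: matrix_vector_mul_assoc)
    then have x: "?x = (\<chi> j. det (\<chi> i i'. if i' = j then real_vec k $ i else ?B $ i $ i') / det ?B)"
      using cramer[OF nz] by blast
    have integral: "real n * ?x $ j \<in> \<int>" for j
    proof -
      let ?C = "\<chi> i i'. if i' = j then real_vec k $ i else ?B $ i $ i'"
      have C: "det ?C \<in> \<int>"
        by (rule int_det) (use B_int in \<open>simp add: real_vec_def\<close>)
      have abs: "\<bar>b\<bar> * y = e \<or> \<bar>b\<bar> * y = - e" if "b \<noteq> 0" "y = e / b" for b y e :: real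
        using that by (cases "b > 0") auto
      have "?x $ j = det ?C / det ?B" by (subst x) simp
      then have "real n * ?x $ j = det ?C \<or> real n * ?x $ j = - det ?C"
        unfolding n(2) by (rule abs[OF nz])
      then show ?thesis using C Ints_minus[OF C] by presburger
    qed
    define l where "l j = \<lfloor>real n * ?x $ j\<rfloor>" for j
    have l: "real_of_int (l j) = real n * ?x $ j" for j
      by (rule Ints_cases[OF integral[of j]]) (simp add: l_def)
    have "?x = (1 / real n) *\<^sub>R real_vec (\<chi> j. l j)"
      using n(1) by (simp add: vec_eq_iff real_vec_def l)
    then show ?thesis
      unfolding k by (intro exI[of _ "\<chi> j. l j"]) (simp only: scaleR_scaleR, simp)
  qed
  with n(1) show ?thesis by (rule that)
qed

lemma dilated_lattice_add:
  assumes "\<sigma> \<in> dilated_lattice M" "\<tau> \<in> dilated_lattice M"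
  shows "\<sigma> + \<tau> \<in> dilated_lattice M"
proof -
  let ?B = "matrix_inv (transpose (map_matrix real_of_int M))"
  obtain k l where "\<sigma> = (2 * pi) *\<^sub>R (?B *v real_vec k)" "\<tau> = (2 * pi) *\<^sub>R (?B *v real_vec l)"
    using assms by (auto simp: dilated_lattice_def)
  then have "\<sigma> + \<tau> = (2 * pi) *\<^sub>R (?B *v real_vec (k + l))"
    by (simp only: real_vec_add matrix_vector_right_distrib scaleR_add_right)
  then show ?thesis unfolding dilated_lattice_def by blast
qed

lemma dilated_lattice_uminus:
  assumes "\<sigma> \<in> dilated_lattice M"
  shows "- \<sigma> \<in> dilated_lattice M"
proof -
  let ?B = "matrix_inv (transpose (map_matrix real_of_int M))"
  obtain k where "\<sigma> = (2 * pi) *\<^sub>R (?B *v real_vec k)"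
    using assms by (auto simp: dilated_lattice_def)
  moreover have "?B *v (- real_vec k) = - (?B *v real_vec k)"
    by (simp add: matrix_vector_mult_def vec_eq_iff sum_negf)
  ultimately have "- \<sigma> = (2 * pi) *\<^sub>R (?B *v real_vec (- k))"
    by (simp only: real_vec_uminus scaleR_minus_right)
  then show ?thesis unfolding dilated_lattice_def by blast
qed

text \<open>As \<open>M\<close> is an integer matrix, \<open>k = M\<^sup>-\<^sup>T (M\<^sup>T k)\<close> with \<open>M\<^sup>T k\<close> integral.\<close>

lemma period_lattice_subset:
  fixes M :: "int ^ 'd ^ ('d::finite)"
  assumes "expansive M"
  shows "period_lattice \<subseteq> dilated_lattice M"
proof
  let ?B = "transpose (map_matrix real_of_int M)"
  fix \<kappa> :: "real ^ 'd"
  assume "\<kappa> \<in> period_lattice"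
  then obtain k where k: "\<kappa> = (2 * pi) *\<^sub>R real_vec k"
    by (auto simp: period_lattice_def)
  have "matrix_inv ?B ** ?B = mat 1"
    by (rule matrix_inv_inverse(2)[OF expansive_det_nonzero[OF assms]])
  then have "matrix_inv ?B *v (?B *v real_vec k) = real_vec k"
    by (metis matrix_vector_mul_assoc matrix_vector_mul_lid)
  moreover have "?B *v real_vec k = real_vec (transpose M *v k)"
    by (simp add: vec_eq_iff real_vec_def matrix_vector_mult_def transpose_def map_matrix_def)
  ultimately have "\<kappa> = (2 * pi) *\<^sub>R (matrix_inv ?B *v real_vec (transpose M *v k))"
    unfolding k by metis
  then show "\<kappa> \<in> dilated_lattice M" unfolding dilated_lattice_def by blast
qed

lemma period_lattice_add:
  "\<sigma> \<in> period_lattice \<Longrightarrow> \<tau> \<in> period_lattice \<Longrightarrow> \<sigma> + \<tau> \<in> period_lattice"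
  unfolding period_lattice_def
  by (clarsimp simp flip: scaleR_add_right real_vec_add)

lemma period_lattice_uminus: "\<sigma> \<in> period_lattice \<Longrightarrow> - \<sigma> \<in> period_lattice"
  unfolding period_lattice_def
  by (clarsimp simp flip: scaleR_minus_right real_vec_uminus)

lemma period_lattice_0: "0 \<in> period_lattice"
  unfolding period_lattice_def by (rule image_eqI[of _ _ 0]) (simp_all add: real_vec_0)

lemma group_dilation_group:
  fixes M :: "int ^ 'd ^ ('d::finite)"
  assumes "expansive M"
  shows "group (dilation_group M)"
proof -
  let ?L = "\<lparr>carrier = dilated_lattice M, monoid.mult = (+), one = 0\<rparr>"
  have 0: "0 \<in> dilated_lattice M"
    using period_lattice_subset[OF assms] period_lattice_0 by blast
  interpret L: comm_group ?L
  proof (rule comm_groupI)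
    fix x assume "x \<in> carrier ?L"
    then show "\<exists>y\<in>carrier ?L. y \<otimes>\<^bsub>?L\<^esub> x = \<one>\<^bsub>?L\<^esub>"
      by (intro bexI[of _ "- x"]) (simp_all add: dilated_lattice_uminus)
  qed (simp_all add: dilated_lattice_add 0 add_ac)
  have inv: "inv\<^bsub>?L\<^esub> x = - x" if "x \<in> dilated_lattice M" for x
    using that by (intro L.inv_equality) (simp_all add: dilated_lattice_uminus)
  have "subgroup period_lattice ?L"
  proof
    show "inv\<^bsub>?L\<^esub> x \<in> period_lattice" if "x \<in> period_lattice" for x
      using that period_lattice_subset[OF assms] by (simp add: inv subsetD period_lattice_uminus)
  qed (use period_lattice_subset[OF assms] in
        \<open>auto simp: period_lattice_add period_lattice_0\<close>)
  then have "period_lattice \<lhd> ?L" by (rule L.subgroup_imp_normal)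
  then show ?thesis
    unfolding dilation_group_def by (rule normal.factorgroup_is_group)
qed

lemma add_mem_mult:
  "\<sigma> \<in> S \<Longrightarrow> \<tau> \<in> T \<Longrightarrow> \<sigma> + \<tau> \<in> S \<otimes>\<^bsub>dilation_group M\<^esub> T"
  by (auto simp: dilation_group_def set_mult_def)

lemma dilation_group_mem:
  assumes "S \<in> carrier (dilation_group M)"
  obtains \<sigma> where "\<sigma> \<in> S" "\<sigma> \<in> dilated_lattice M" "S = (\<lambda>\<kappa>. \<sigma> + \<kappa>) ` period_lattice"
proof -
  obtain \<tau> where t: "\<tau> \<in> dilated_lattice M" "S = (\<lambda>\<kappa>. \<tau> + \<kappa>) ` period_lattice"
    using assms by (rule dilation_group_coset)
  moreover have "\<tau> \<in> S"
    unfolding t(2) by (rule image_eqI[of _ _ 0]) (simp_all add: period_lattice_0)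
  ultimately show ?thesis using that by blast
qed

lemma coset_eqI:
  fixes \<sigma> \<tau> :: "real ^ ('d::finite)"
  assumes "\<tau> - \<sigma> \<in> period_lattice"
  shows "(\<lambda>\<kappa>. \<sigma> + \<kappa>) ` period_lattice = (\<lambda>\<kappa>. \<tau> + \<kappa>) ` period_lattice"
proof -
  have "(\<lambda>\<kappa>. \<tau> + \<kappa>) ` period_lattice = (\<lambda>\<kappa>. \<sigma> + \<kappa>) ` ((\<lambda>\<kappa>. (\<tau> - \<sigma>) + \<kappa>) ` period_lattice)"
    by (simp add: image_image add.assoc[symmetric])
  also have "(\<lambda>\<kappa>. (\<tau> - \<sigma>) + \<kappa>) ` period_lattice = period_lattice"
  proof (intro equalityI subsetI)
    fix \<kappa> :: "real ^ 'd" assume "\<kappa> \<in> period_lattice"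
    then show "\<kappa> \<in> (\<lambda>\<kappa>. (\<tau> - \<sigma>) + \<kappa>) ` period_lattice"
      using period_lattice_add[OF period_lattice_uminus[OF assms]]
      by (intro image_eqI[of _ _ "- (\<tau> - \<sigma>) + \<kappa>"]) simp_all
  qed (use period_lattice_add[OF assms] in auto)
  finally show ?thesis by simp
qed

text \<open>
  A point of the dilated lattice is \<open>(2\<pi> / n) l\<close> with \<open>l\<close> integral, and its coset depends only on the
  residues of the coordinates of \<open>l\<close> modulo \<open>n\<close>.
\<close>

lemma finite_dilation_group:
  fixes M :: "int ^ 'd ^ ('d::finite)"
  assumes "expansive M"
  shows "finite (carrier (dilation_group M))"
proof -
  obtain n :: nat where n: "n > 0"
    "\<And>\<sigma>. \<sigma> \<in> dilated_lattice M \<Longrightarrow> \<exists>l. \<sigma> = (2 * pi / real n) *\<^sub>R real_vec l"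
    by (rule dilated_lattice_torsion[OF assms]) blast
  let ?F = "PiE (UNIV :: 'd set) (\<lambda>_. {0..<int n})"
  let ?c = "\<lambda>f. (\<lambda>\<kappa>. (2 * pi / real n) *\<^sub>R real_vec (\<chi> j. f j) + \<kappa>) ` period_lattice"
  have "carrier (dilation_group M) \<subseteq> ?c ` ?F"
  proof
    fix S assume "S \<in> carrier (dilation_group M)"
    then obtain \<sigma> where \<sigma>: "\<sigma> \<in> dilated_lattice M" "S = (\<lambda>\<kappa>. \<sigma> + \<kappa>) ` period_lattice"
      by (rule dilation_group_coset)
    obtain l where l: "\<sigma> = (2 * pi / real n) *\<^sub>R real_vec l"
      using n(2)[OF \<sigma>(1)] by blast
    define f where "f j = l $ j mod int n" for j
    have "\<sigma> - (2 * pi / real n) *\<^sub>R real_vec (\<chi> j. f j)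
        = (2 * pi) *\<^sub>R real_vec (\<chi> j. l $ j div int n)"
    proof -
      have "real_of_int (l $ j) = real_of_int (f j) + real n * real_of_int (l $ j div int n)" for j
        unfolding f_def by (metis mod_mult_div_eq of_int_add of_int_mult of_int_of_nat_eq)
      then show ?thesis
        using n(1) by (simp add: l vec_eq_iff real_vec_def field_simps)
    qed
    then have "S = ?c f"
      unfolding \<sigma>(2) by (intro coset_eqI[symmetric]) (simp add: period_lattice_def)
    moreover have "f \<in> ?F" using n(1) by (auto simp: f_def)
    ultimately show "S \<in> ?c ` ?F" by blast
  qed
  moreover have "finite ?F" by (intro finite_PiE) simp_all
  ultimately show ?thesis by (meson finite_imageI finite_subset)
qed

lemma same_coset_iff:
  assumes "S \<in> carrier (dilation_group M)" "T \<in> carrier (dilation_group M)"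
    and "\<sigma> \<in> S" "\<tau> \<in> T"
  shows "\<tau> - \<sigma> \<in> period_lattice \<longleftrightarrow> S = T"
proof -
  obtain \<mu> where S: "S = (\<lambda>\<kappa>. \<mu> + \<kappa>) ` period_lattice"
    by (rule dilation_group_coset[OF assms(1)]) blast
  obtain \<nu> where T: "T = (\<lambda>\<kappa>. \<nu> + \<kappa>) ` period_lattice"
    by (rule dilation_group_coset[OF assms(2)]) blast
  obtain \<kappa> where \<kappa>: "\<kappa> \<in> period_lattice" "\<sigma> = \<mu> + \<kappa>" using assms(3) S by blast
  obtain \<eta> where \<eta>: "\<eta> \<in> period_lattice" "\<tau> = \<nu> + \<eta>" using assms(4) T by blast
  show ?thesis
  proof
    assume "\<tau> - \<sigma> \<in> period_lattice"
    then have "(\<tau> - \<sigma>) + (\<kappa> + - \<eta>) \<in> period_lattice"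
      using \<kappa>(1) \<eta>(1) by (intro period_lattice_add period_lattice_uminus)
    then have "\<nu> - \<mu> \<in> period_lattice" by (simp add: \<kappa>(2) \<eta>(2))
    then show "S = T" unfolding S T by (rule coset_eqI)
  next
    assume "S = T"
    then obtain \<eta>' where \<eta>': "\<eta>' \<in> period_lattice" "\<tau> = \<mu> + \<eta>'" using assms(4) S by blast
    then have "\<eta>' + - \<kappa> \<in> period_lattice"
      using \<kappa>(1) by (intro period_lattice_add period_lattice_uminus)
    then show "\<tau> - \<sigma> \<in> period_lattice" by (simp add: \<kappa>(2) \<eta>'(2))
  qed
qed

section \<open>Twisting as a group action, and the frame of monomials\<close>

text \<open>
  On a coset, twisting is the shift by any of its representatives, and a sum of representatives
  represents the product of the cosets; so the properties of shifts carry over.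
\<close>

lemma star_action_twist:
  fixes M :: "int ^ 'd ^ ('d::finite)"
  assumes "expansive M"
  shows "star_action (dilation_group M) (laurent_star :: 'd laurent \<Rightarrow> 'd laurent) twist"
proof -
  interpret group "dilation_group M" by (rule group_dilation_group[OF assms])
  show ?thesis
  proof
    show "finite (carrier (dilation_group M))" by (rule finite_dilation_group[OF assms])
    show "laurent_star (x + y) = laurent_star x + laurent_star y" for x y :: "'d laurent"
      by (rule trig_inject) (simp add: trig_laurent_star trig_add)
    show "laurent_star (x * y) = laurent_star x * laurent_star y" for x y :: "'d laurent"
      by (rule trig_inject) (simp add: trig_laurent_star trig_mult)
    show "laurent_star (laurent_star x) = x" for x :: "'d laurent"
      by (rule trig_inject) (simp add: trig_laurent_star)
    fix S assume S: "S \<in> carrier (dilation_group M)"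
    then obtain \<sigma> where \<sigma>: "\<sigma> \<in> S" by (rule dilation_group_mem)
    note twist = twist_eq_shift[OF S \<sigma>]
    show "twist (x + y) S = twist x S + twist y S" for x y
      by (simp add: twist shift_add)
    show "twist (x * y) S = twist x S * twist y S" for x y
      by (simp add: twist shift_mult)
    show "twist (laurent_star x) S = laurent_star (twist x S)" for x
      by (simp add: twist shift_star)
    fix T assume T: "T \<in> carrier (dilation_group M)"
    then obtain \<tau> where \<tau>: "\<tau> \<in> T" by (rule dilation_group_mem)
    show "twist (twist x S) T = twist x (S \<otimes>\<^bsub>dilation_group M\<^esub> T)" for x
      using twist_eq_shift[OF m_closed[OF S T] add_mem_mult[OF \<sigma> \<tau>]]
      by (simp add: twist twist_eq_shift[OF T \<tau>] shift_shift)
  next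
    have "0 \<in> \<one>\<^bsub>dilation_group M\<^esub>"
      by (simp add: dilation_group_def period_lattice_0)
    then show "twist x \<one>\<^bsub>dilation_group M\<^esub> = x" for x
      by (simp add: twist_eq_shift[OF one_closed] shift_0)
  qed
qed

lemma cis_eq_1_imp:
  assumes "cis t = 1"
  shows "\<exists>l::int. t = 2 * pi * real_of_int l"
proof -
  have "cos t = 1" using assms by (simp add: complex_eq_iff)
  then show ?thesis by (simp add: cos_one_2pi_int mult_ac)
qed

text \<open>
  The sum factors into the geometric sums \<open>\<Sum>\<^sub>i\<^sub><\<^sub>n \<zeta>\<^sup>i\<close> with \<open>\<zeta> = e\<^sup>-\<^sup>i\<^sup>\<theta>\<^sup>j\<close> an \<open>n\<close>-th root of unity, for each
  coordinate \<open>\<theta>\<^sub>j\<close>.  Such a sum vanishes unless \<open>\<zeta> = 1\<close>, and all these roots equal 1 exactly when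
  \<open>\<theta>\<close> is a period.
\<close>

lemma character_sum_over_box:
  fixes \<theta> :: "real ^ ('d::finite)"
  assumes n: "n > 0" and \<theta>: "\<theta> = (2 * pi / real n) *\<^sub>R real_vec l"
  shows "(\<Sum>f\<in>PiE UNIV (\<lambda>_. {..<n}). cis (- (real_vec (\<chi> j. int (f j)) \<bullet> \<theta>)))
    = (if \<theta> \<in> period_lattice then of_nat (n ^ CARD('d)) else 0)"
proof -
  have "(\<Sum>f\<in>PiE (UNIV :: 'd set) (\<lambda>_. {..<n}). cis (- (real_vec (\<chi> j. int (f j)) \<bullet> \<theta>)))
      = (\<Sum>f\<in>PiE (UNIV :: 'd set) (\<lambda>_. {..<n}). \<Prod>j\<in>UNIV. cis (- (\<theta> $ j)) ^ f j)"
  proof (rule sum.cong)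
    fix f :: "'d \<Rightarrow> nat"
    show "cis (- (real_vec (\<chi> j. int (f j)) \<bullet> \<theta>)) = (\<Prod>j\<in>UNIV. cis (- (\<theta> $ j)) ^ f j)"
      by (simp add: real_vec_inner cis_conv_exp exp_sum sum_negf[symmetric] sum_distrib_left
          exp_of_nat_mult[symmetric]) (simp add: mult_ac)
  qed simp
  also have "\<dots> = (\<Prod>j\<in>UNIV. \<Sum>i<n. cis (- (\<theta> $ j)) ^ i)"
    by (subst prod_sum_PiE) simp_all
  also have "\<dots> = (if \<theta> \<in> period_lattice then of_nat (n ^ CARD('d)) else 0)"
  proof (cases "\<forall>j. cis (- (\<theta> $ j)) = 1")
    case True
    then have "\<exists>k::int. \<theta> $ j = 2 * pi * real_of_int k" for j
      using cis_eq_1_imp[of "- (\<theta> $ j)"] by (metis add.inverse_inverse mult_minus_right of_int_minus)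
    then obtain k where "\<And>j. \<theta> $ j = 2 * pi * real_of_int (k j)" by metis
    then have "\<theta> = (2 * pi) *\<^sub>R real_vec (\<chi> j. k j)"
      by (simp add: vec_eq_iff real_vec_def)
    then have "\<theta> \<in> period_lattice" by (simp add: period_lattice_def)
    with True show ?thesis by simp
  next
    case False
    then obtain j where j: "cis (- (\<theta> $ j)) \<noteq> 1" by blast
    have "real n * - (\<theta> $ j) = 2 * pi * real_of_int (- l $ j)"
      using n by (simp add: \<theta> real_vec_def)
    then have "cis (- (\<theta> $ j)) ^ n = cis (2 * pi * real_of_int (- l $ j))"
      by (simp only: Complex.DeMoivre)
    then have "cis (- (\<theta> $ j)) ^ n = 1"
      by (simp add: cis_multiple_2pi del: of_int_minus)
    then have "(\<Sum>i<n. cis (- (\<theta> $ j)) ^ i) = 0"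
      using j by (simp add: sum_gp_strict)
    then have "(\<Prod>j\<in>UNIV. \<Sum>i<n. cis (- (\<theta> $ j)) ^ i) = 0"
      by (intro prod_zero) auto
    moreover have "\<theta> \<notin> period_lattice"
    proof
      assume "\<theta> \<in> period_lattice"
      then obtain k where "\<theta> = (2 * pi) *\<^sub>R real_vec k" by (auto simp: period_lattice_def)
      then have "- (\<theta> $ j) = 2 * pi * real_of_int (- k $ j)" by (simp add: real_vec_def)
      with j show False by (metis cis_multiple_2pi Ints_of_int)
    qed
    ultimately show ?thesis by simp
  qed
  finally show ?thesis .
qed

lemma cnj_mult_inverse_sqrt:
  assumes "N > 0"
  shows "cnj (complex_of_real (1 / sqrt (real N))) * complex_of_real (1 / sqrt (real N)) * of_nat N = 1"
proof -
  have "(1 / sqrt (real N)) * (1 / sqrt (real N)) * real N = 1"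
    using assms by (simp add: divide_simps)
  then have "complex_of_real ((1 / sqrt (real N)) * (1 / sqrt (real N)) * real N) = 1"
    by (simp only: of_real_1)
  then show ?thesis
    by (simp only: of_real_mult complex_cnj_complex_of_real of_real_of_nat_eq)
qed

text \<open>
  For monomials, \<open>a\<^sub>k\<^sup>\<sigma>\<^sup>* a\<^sub>k\<^sup>\<tau>\<close> is the constant \<open>n\<^sup>-\<^sup>d e\<^sup>-\<^sup>i\<^sup>k\<^sup>(\<^sup>\<tau>\<^sup>-\<^sup>\<sigma>\<^sup>)\<close>, so the frame identity is the
  orthogonality relation for the character at \<open>\<theta> = \<tau> - \<sigma>\<close>.  The factor \<open>c\<close> is the constant \<open>1 / \<surd>|G|\<close>.
\<close>

lemma framed_star_action_twist:
  fixes M :: "int ^ 'd ^ ('d::finite)"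
  assumes "expansive M"
  obtains K :: "('d \<Rightarrow> nat) set" and a c where
    "framed_star_action (dilation_group M) (laurent_star :: 'd laurent \<Rightarrow> 'd laurent) twist K a c"
proof -
  interpret star_action "dilation_group M" "laurent_star :: 'd laurent \<Rightarrow> 'd laurent" twist
    by (rule star_action_twist[OF assms])
  obtain n :: nat where n: "n > 0"
    "\<And>\<sigma>. \<sigma> \<in> dilated_lattice M \<Longrightarrow> \<exists>l. \<sigma> = (2 * pi / real n) *\<^sub>R real_vec l"
    by (rule dilated_lattice_torsion[OF assms]) blast
  define s where "s = complex_of_real (1 / sqrt (real (n ^ CARD('d))))"
  define a :: "('d \<Rightarrow> nat) \<Rightarrow> 'd laurent"
    where "a f = Poly_Mapping.single (\<chi> j. int (f j)) s" for f
  define t where "t = complex_of_real (1 / sqrt (real (card (carrier (dilation_group M)))))"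
  let ?K = "PiE (UNIV :: 'd set) (\<lambda>_. {..<n})"
  have ss: "cnj s * s * of_nat (n ^ CARD('d)) = 1"
    unfolding s_def by (rule cnj_mult_inverse_sqrt) (use n(1) in simp)
  have "card (carrier (dilation_group M)) > 0"
    using finite_carrier one_closed by (auto simp: card_gt_0_iff)
  then have tt: "cnj t * t * of_nat (card (carrier (dilation_group M))) = 1"
    unfolding t_def by (rule cnj_mult_inverse_sqrt)
  have trig_of_nat: "trig (of_nat m :: 'd laurent) \<omega> = of_nat m" for m \<omega>
    using trig_single[of "0 :: int ^ 'd" "of_nat m" \<omega>] by (simp add: real_vec_0)
  have trig_const: "trig (Poly_Mapping.single 0 t :: 'd laurent) \<omega> = t" for \<omega>
    by (simp add: trig_single real_vec_0)
  have "framed_star_action (dilation_group M) (laurent_star :: 'd laurent \<Rightarrow> 'd laurent) twist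
      ?K a (Poly_Mapping.single 0 t)"
  proof
    show "finite ?K" by (intro finite_PiE) simp_all
    show "laurent_star (Poly_Mapping.single 0 t) * Poly_Mapping.single 0 t
        * of_nat (card (carrier (dilation_group M))) = (1 :: 'd laurent)"
      using tt trig_of_nat[of 1]
      by (intro trig_inject) (simp add: trig_mult trig_laurent_star trig_of_nat trig_const)
    fix S assume S: "S \<in> carrier (dilation_group M)"
    then obtain \<sigma> where \<sigma>: "\<sigma> \<in> S" "\<sigma> \<in> dilated_lattice M" by (rule dilation_group_mem)
    show "twist (Poly_Mapping.single 0 t) S = Poly_Mapping.single 0 t"
      by (rule trig_inject) (simp add: twist_eq_shift[OF S \<sigma>(1)] trig_shift trig_const)
    fix T assume T: "T \<in> carrier (dilation_group M)"
    then obtain \<tau> where \<tau>: "\<tau> \<in> T" "\<tau> \<in> dilated_lattice M" by (rule dilation_group_mem)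
    have "\<tau> - \<sigma> \<in> dilated_lattice M"
      using dilated_lattice_add[OF \<tau>(2) dilated_lattice_uminus[OF \<sigma>(2)]] by simp
    then obtain l where l: "\<tau> - \<sigma> = (2 * pi / real n) *\<^sub>R real_vec l" using n(2) by blast
    note diff = same_coset_iff[OF S T \<sigma>(1) \<tau>(1)]
    show "(\<Sum>k\<in>?K. laurent_star (twist (a k) S) * twist (a k) T) = (if S = T then 1 else 0)"
    proof (rule trig_inject)
      fix \<omega>
      have "trig (laurent_star (twist (a f) S) * twist (a f) T) \<omega>
          = cnj s * s * cis (- (real_vec (\<chi> j. int (f j)) \<bullet> (\<tau> - \<sigma>)))" for f
        by (simp add: trig_mult trig_laurent_star twist_eq_shift[OF S \<sigma>(1)]
            twist_eq_shift[OF T \<tau>(1)] trig_shift a_def trig_single cis_cnj cis_mult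
            inner_add_right inner_diff_right)
      then have "trig (\<Sum>k\<in>?K. laurent_star (twist (a k) S) * twist (a k) T) \<omega>
          = cnj s * s * (\<Sum>f\<in>?K. cis (- (real_vec (\<chi> j. int (f j)) \<bullet> (\<tau> - \<sigma>))))"
        by (simp add: trig_sum sum_distrib_left)
      also have "\<dots> = (if S = T then 1 else 0)"
        unfolding character_sum_over_box[OF n(1) l] diff using ss by simp
      finally show "trig (\<Sum>k\<in>?K. laurent_star (twist (a k) S) * twist (a k) T) \<omega>
          = trig (if S = T then 1 else 0) \<omega>"
        using trig_of_nat[of 1 \<omega>] trig_of_nat[of 0 \<omega>] by simp
    qed
  qed
  then show ?thesis by (rule that)
qed

theorem theorem3p8:
  fixes M :: "int ^ 'd ^ ('d::finite)" and p :: "'d laurent"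
  assumes "expansive M"
    and "laurent_eval p (\<chi> j. 1) = 1"
  shows "(\<exists>(r::nat) (h :: nat \<Rightarrow> 'd laurent).
            1 - (\<Sum>\<sigma>\<in>carrier (dilation_group M). laurent_star (twist p \<sigma>) * twist p \<sigma>)
              = (\<Sum>j=1..r. laurent_star (h j) * h j))
     \<longleftrightarrow> (\<exists>(N::nat) (q :: nat \<Rightarrow> 'd laurent).
            \<forall>\<sigma>\<in>carrier (dilation_group M). \<forall>\<tau>\<in>carrier (dilation_group M).
              (if \<sigma> = \<tau> then 1 else 0) - laurent_star (twist p \<sigma>) * twist p \<tau>
                = (\<Sum>j=1..N. laurent_star (twist (q j) \<sigma>) * twist (q j) \<tau>))"
proof -
  obtain K :: "('d \<Rightarrow> nat) set" and a c where
    framed: "framed_star_action (dilation_group M) (laurent_star :: 'd laurent \<Rightarrow> 'd laurent)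
      twist K a c"
    by (rule framed_star_action_twist[OF assms(1)])
  interpret framed_star_action "dilation_group M" "laurent_star :: 'd laurent \<Rightarrow> 'd laurent"
    twist K a c by (rule framed)
  show ?thesis
  proof (intro iffI; elim exE)
    fix r and h :: "nat \<Rightarrow> 'd laurent"
    assume h: "1 - (\<Sum>\<sigma>\<in>carrier (dilation_group M). laurent_star (twist p \<sigma>) * twist p \<sigma>)
      = (\<Sum>j=1..r. laurent_star (h j) * h j)"
    show "\<exists>(N::nat) (q :: nat \<Rightarrow> 'd laurent).
            \<forall>\<sigma>\<in>carrier (dilation_group M). \<forall>\<tau>\<in>carrier (dilation_group M).
              (if \<sigma> = \<tau> then 1 else 0) - laurent_star (twist p \<sigma>) * twist p \<tau>
                = (\<Sum>j=1..N. laurent_star (twist (q j) \<sigma>) * twist (q j) \<tau>)"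
      by (rule matrix_factorization_of_sum_of_squares[OF h[folded defect_eq]])
  next
    fix N and q :: "nat \<Rightarrow> 'd laurent"
    assume q: "\<forall>\<sigma>\<in>carrier (dilation_group M). \<forall>\<tau>\<in>carrier (dilation_group M).
              (if \<sigma> = \<tau> then 1 else 0) - laurent_star (twist p \<sigma>) * twist p \<tau>
                = (\<Sum>j=1..N. laurent_star (twist (q j) \<sigma>) * twist (q j) \<tau>)"
    show "\<exists>(r::nat) (h :: nat \<Rightarrow> 'd laurent).
            1 - (\<Sum>\<sigma>\<in>carrier (dilation_group M). laurent_star (twist p \<sigma>) * twist p \<sigma>)
              = (\<Sum>j=1..r. laurent_star (h j) * h j)"
      unfolding defect_eq[symmetric]
      by (rule sum_of_squares_of_matrix_factorization[OF q[rule_format]])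
  qed
qed

end
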